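(* Let $k,d\in\mathbb{N}$ with $k\le d$, let $A_1,\dots,A_k\subseteq\overline{\mathbb{R}}$ be non-empty subsets and $A:=A_1\times\dots\times A_k$. Let $g_1,\dots,g_d:A\to[0,1]$ and $f:\{0,1\}^d\to\mathbb{R}$ be given, and define $h:A\to\mathbb{R}$ by $$h(x):=\sum_{\alpha\subseteq[d]} f(\alpha)\prod_{i\in\alpha}g_i(x)\prod_{j\in[d]\setminus\alpha}\bigl(1-g_j(x)\bigr),$$ with empty products equal to $1$. If $g_1,\dots,g_d$ are fully $k$-increasing (as functions on $A\subseteq\overline{\mathbb{R}}^k$) and $f$ is fully $k$-increasing (as a function on $\{0,1\}^d$), then $h$ is fully $k$-increasing on $A$.
   Context: Notation: $[d]=\{1,\dots,d\}$; a subset $\alpha\subseteq[d]$ is identified with its indicator vector $1_\alpha\in\{0,1\}^d$, so $f(\alpha)=f(1_\alpha)$. For $\mathbf p\in\{0,1\}^m$ write $|\mathbf p|=\sum_i p_i$, and for vectors $x\odot y=(x_1y_1,x_2y_2,\dots)$; $\le$ on vectors is coordinatewise. Let $I=I_1\times\dots\times I_m$ with non-empty $I_j\subseteq\overline{\mathbb{R}}$ and $F:I\to\mathbb{R}$. For $s\in I$, $h\in\mathbb{R}_+^m$ (with $\pm\infty+t=\pm\infty$) and $\mathbf p\in\{0,1\}^m$ put $$(\Delta^{\mathbf p}_h F)(s):=\sum_{\mathbf q\in\{0,1\}^m,\ \mathbf q\le\mathbf p}(-1)^{|\mathbf p|-|\mathbf q|}F(s+\mathbf q\odot h).$$ For $1\le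 k\le m$, $F$ is called fully $k$-increasing if $(\Delta^{\mathbf p}_hF)(s)\ge0$ for every $\mathbf p\in\{0,1\}^m$ with $\mathbf p\ne0$ and $|\mathbf p|\le k$, and every $s\in I$, $h\in\mathbb{R}_+^m$ such that $s+\mathbf q\odot h\in I$ for all $\mathbf q\in\{0,1\}^m$ with $\mathbf q\le\mathbf p$. (For $g_i$ on $A$ one has $m=k$; for $f$ on $\{0,1\}^d$ one has $m=d$, $I_j=\{0,1\}$.) *)

theory Defs
  imports "HOL-Library.Extended_Real" "HOL-Library.FuncSet" "HOL-Library.Indicator_Function"
begin

text \<open>
  Vectors of length \<open>m\<close> are functions on \<open>{1..m}\<close>, represented extensionally (\<open>undefined\<close> outside
  \<open>{1..m}\<close>), so that equality of vectors is coordinatewise equality and a product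
  \<open>I\<^sub>1 \<times> \<dots> \<times> I\<^sub>m\<close> is \<open>\<Pi>\<^sub>E i\<in>{1..m}. I i\<close>.
\<close>

definition prod_box :: "nat \<Rightarrow> (nat \<Rightarrow> 'a set) \<Rightarrow> (nat \<Rightarrow> 'a) set" where
  "prod_box m I = (\<Pi>\<^sub>E i\<in>{1..m}. I i)"

definition cube :: "nat \<Rightarrow> (nat \<Rightarrow> nat) set" where
  "cube m = prod_box m (\<lambda>_. {0, 1})"

definition zero_vec :: "nat \<Rightarrow> nat \<Rightarrow> nat" where
  "zero_vec m = (\<lambda>i\<in>{1..m}. 0)"

definition weight :: "nat \<Rightarrow> (nat \<Rightarrow> nat) \<Rightarrow> nat" where
  "weight m p = (\<Sum>i\<in>{1..m}. p i)"

text \<open>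
  \<open>shift m s q t\<close> is \<open>s + q \<odot> t\<close>. The increment \<open>q i * t i\<close> is a finite real, so addition on
  \<^typ>\<open>ereal\<close> leaves \<open>\<plusminus>\<infinity>\<close> fixed.
\<close>

definition shift ::
  "nat \<Rightarrow> (nat \<Rightarrow> ereal) \<Rightarrow> (nat \<Rightarrow> nat) \<Rightarrow> (nat \<Rightarrow> real) \<Rightarrow> (nat \<Rightarrow> ereal)" where
  "shift m s q t = (\<lambda>i\<in>{1..m}. s i + ereal (real (q i) * t i))"

definition below :: "nat \<Rightarrow> (nat \<Rightarrow> nat) \<Rightarrow> (nat \<Rightarrow> nat) set" where
  "below m p = {q \<in> cube m. \<forall>i\<in>{1..m}. q i \<le> p i}"

text \<open>For \<open>q \<in> below m p\<close> the natural-number subtraction in the exponent does not truncate.\<close>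

definition Delta ::
  "nat \<Rightarrow> (nat \<Rightarrow> nat) \<Rightarrow> (nat \<Rightarrow> real) \<Rightarrow> ((nat \<Rightarrow> ereal) \<Rightarrow> real) \<Rightarrow> (nat \<Rightarrow> ereal) \<Rightarrow> real"
where
  "Delta m p t F s = (\<Sum>q\<in>below m p. (-1) ^ (weight m p - weight m q) * F (shift m s q t))"

text \<open>
  \<open>fully_increasing m k I F\<close>: the function \<open>F\<close> on \<open>I 1 \<times> \<dots> \<times> I m\<close> is fully \<open>k\<close>-increasing; it is
  meant for \<open>1 \<le> k \<le> m\<close>. Only values of \<open>F\<close> on that product enter.
\<close>

definition fully_increasing ::
  "nat \<Rightarrow> nat \<Rightarrow> (nat \<Rightarrow> ereal set) \<Rightarrow> ((nat \<Rightarrow> ereal) \<Rightarrow> real) \<Rightarrow> bool" where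
  "fully_increasing m k I F \<longleftrightarrow>
    (\<forall>p \<in> cube m. p \<noteq> zero_vec m \<longrightarrow> weight m p \<le> k \<longrightarrow>
      (\<forall>s \<in> prod_box m I. \<forall>t \<in> prod_box m (\<lambda>_. {0..}).
        (\<forall>q \<in> below m p. shift m s q t \<in> prod_box m I) \<longrightarrow> 0 \<le> Delta m p t F s))"

text \<open>The vector \<open>1\<^sub>\<alpha> \<in> {0,1}\<^sup>d\<close> identified with a subset \<open>\<alpha>\<close> of \<open>{1..d}\<close>.\<close>

definition ind_vec :: "nat \<Rightarrow> nat set \<Rightarrow> nat \<Rightarrow> ereal" where
  "ind_vec d \<alpha> = (\<lambda>i\<in>{1..d}. indicator \<alpha> i)"

end

(*
  On a box s + q * t with q <= p, a function is a function of the set T of coordinates in which q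
  is 1, and its finite differences at s are the Moebius coefficients of that set function.  The
  differences of g_i at the base point alone make all Moebius coefficients of g_i nonnegative.  The
  function h is the multiaffine extension of f evaluated at (g_1, ..., g_d).  Adding one element to T and
  changing the arguments g_1, ..., g_d one after the other telescopes the difference of h into a sum of
  terms (increment of g_b) * (b-th partial derivative of the extension at a mixture of old and new
  arguments).  The partial derivative is the extension of the b-th difference of f, which is
  (k-1)-increasing, so induction applies to the second factor, and products of functions with
  nonnegative Moebius coefficients have nonnegative Moebius coefficients.
*)
theory Submission
  imports Defs
begin

section \<open>Moebius coefficients of set functions\<close>

text \<open>For finite \<open>S\<close>, Moebius inversion gives \<open>F S\<close> as the sum of
  \<open>moebius F W\<close> over \<open>W \<subseteq> S\<close>. The exponent does not truncate
  then, since \<open>card T \<le> card S\<close>.\<close>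

definition moebius :: "('a set \<Rightarrow> real) \<Rightarrow> 'a set \<Rightarrow> real" where
  "moebius F S = (\<Sum>T\<in>Pow S. (-1) ^ (card S - card T) * F T)"

lemma moebius_empty [simp]: "moebius F {} = F {}"
  by (simp add: moebius_def)

lemma moebius_cong: "(\<And>T. T \<subseteq> S \<Longrightarrow> F T = G T) \<Longrightarrow> moebius F S = moebius G S"
  unfolding moebius_def by (intro sum.cong) auto

lemma moebius_add: "moebius (\<lambda>T. F T + G T) S = moebius F S + moebius G S"
  unfolding moebius_def by (simp add: sum.distrib distrib_left)

lemma moebius_diff: "moebius (\<lambda>T. F T - G T) S = moebius F S - moebius G S"
  unfolding moebius_def by (simp add: sum_subtractf right_diff_distrib)

lemma sum_Pow_insert:
  assumes "finite S" "a \<notin> S"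
  shows "sum u (Pow (insert a S)) = (\<Sum>T\<in>Pow S. u T + u (insert a T))"
proof -
  have inj: "inj_on (insert a) (Pow S)"
    using assms(2) by (auto simp: inj_on_def)
  have "sum u (Pow (insert a S)) = sum u (Pow S) + sum u (insert a ` Pow S)"
    unfolding Pow_insert using assms by (intro sum.union_disjoint) auto
  also have "\<dots> = (\<Sum>T\<in>Pow S. u T + u (insert a T))"
    by (simp add: sum.reindex[OF inj] sum.distrib)
  finally show ?thesis .
qed

text \<open>The terms at \<open>T\<close> and \<open>insert a T\<close> carry opposite signs and
  pair up. This recursion drives the inductions on sets below.\<close>

lemma moebius_insert:
  assumes "finite S" "a \<notin> S"
  shows "moebius F (insert a S) = moebius (\<lambda>T. F (insert a T) - F T) S"
  unfolding moebius_def sum_Pow_insert[OF assms]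
proof (rule sum.cong[OF refl])
  fix T assume "T \<in> Pow S"
  then have T: "T \<subseteq> S" "finite T" "a \<notin> T" "card T \<le> card S"
    using assms by (auto intro: finite_subset card_mono)
  then show "(-1) ^ (card (insert a S) - card T) * F T
      + (-1) ^ (card (insert a S) - card (insert a T)) * F (insert a T)
      = (-1) ^ (card S - card T) * (F (insert a T) - F T)"
    using assms by (simp add: Suc_diff_le algebra_simps)
qed

lemma moebius_const:
  assumes "finite S" "S \<noteq> {}"
  shows "moebius (\<lambda>_. c) S = 0"
proof -
  obtain a R where "S = insert a R" "a \<notin> R"
    using assms(2) by (meson Set.set_insert all_not_in_conv)
  with assms(1) have "moebius (\<lambda>_. c) S = moebius (\<lambda>_. 0) R"
    by (simp add: moebius_insert)
  then show ?thesis
    by (simp add: moebius_def)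
qed

text \<open>\<open>W = {}\<close> is included, which forces \<open>0 \<le> F {}\<close>. Without it
  products would fail: a negative constant factor reverses the sign of every increment.\<close>

definition moebius_nonneg :: "'a set \<Rightarrow> ('a set \<Rightarrow> real) \<Rightarrow> bool" where
  "moebius_nonneg S F \<longleftrightarrow> (\<forall>W\<subseteq>S. 0 \<le> moebius F W)"

lemma moebius_nonneg_add:
  "moebius_nonneg S F \<Longrightarrow> moebius_nonneg S G \<Longrightarrow> moebius_nonneg S (\<lambda>T. F T + G T)"
  unfolding moebius_nonneg_def by (simp add: moebius_add)

lemma moebius_nonneg_sum:
  assumes "\<And>i. i \<in> L \<Longrightarrow> moebius_nonneg S (F i)"
  shows "moebius_nonneg S (\<lambda>T. \<Sum>i\<in>L. F i T)"
proof -
  have "moebius_nonneg S (\<lambda>T. 0)"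
    by (simp add: moebius_nonneg_def moebius_def)
  with assms show ?thesis
    by (induction L rule: infinite_finite_induct) (simp_all add: moebius_nonneg_add)
qed

lemma moebius_nonneg_insert:
  assumes "finite S" "a \<notin> S"
  shows "moebius_nonneg (insert a S) F \<longleftrightarrow>
    moebius_nonneg S F \<and> moebius_nonneg S (\<lambda>T. F (insert a T) - F T)"
proof -
  have *: "moebius F (insert a W) = moebius (\<lambda>T. F (insert a T) - F T) W" if "W \<subseteq> S" for W
    using that assms by (intro moebius_insert) (auto intro: finite_subset)
  have "moebius_nonneg (insert a S) F \<longleftrightarrow>
    (\<forall>W\<in>Pow S \<union> insert a ` Pow S. 0 \<le> moebius F W)"
    unfolding moebius_nonneg_def Pow_insert[symmetric] by auto
  also have "\<dots> \<longleftrightarrow> (\<forall>W\<subseteq>S. 0 \<le> moebius F W) \<and> (\<forall>W\<subseteq>S. 0 \<le> moebius F (insert a W))"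
    by auto
  finally show ?thesis
    unfolding moebius_nonneg_def using * by simp
qed

text \<open>Discrete product rule: the increment of \<open>F * G\<close> in direction
  \<open>a\<close> is \<open>?dF T * G (insert a T) + F T * ?dG T\<close>, with
  \<open>G (insert a T)\<close> written as \<open>G T + ?dG T\<close>, a sum of two admissible
  functions.\<close>

lemma moebius_nonneg_mult:
  assumes "finite S" "moebius_nonneg S F" "moebius_nonneg S G"
  shows "moebius_nonneg S (\<lambda>T. F T * G T)"
  using assms
proof (induction S arbitrary: F G rule: finite_induct)
  case empty
  then show ?case by (simp add: moebius_nonneg_def)
next
  case (insert a S)
  let ?dF = "\<lambda>T. F (insert a T) - F T" and ?dG = "\<lambda>T. G (insert a T) - G T"
  from insert have pos: "moebius_nonneg S F" "moebius_nonneg S ?dF"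
      "moebius_nonneg S G" "moebius_nonneg S ?dG"
    by (simp_all add: moebius_nonneg_insert)
  then have "moebius_nonneg S (\<lambda>T. G T + ?dG T)"
    by (intro moebius_nonneg_add)
  then have "moebius_nonneg S (\<lambda>T. ?dF T * (G T + ?dG T) + F T * ?dG T)"
    using pos by (intro moebius_nonneg_add insert.IH)
  then have "moebius_nonneg S (\<lambda>T. F (insert a T) * G (insert a T) - F T * G T)"
    by (simp add: algebra_simps)
  moreover have "moebius_nonneg S (\<lambda>T. F T * G T)"
    using pos by (intro insert.IH)
  ultimately show ?case
    using insert.hyps by (simp add: moebius_nonneg_insert)
qed

section \<open>Multiaffine extensions\<close>

text \<open>For finite \<open>D\<close> and \<open>y\<close> with values in [0,1], this is the
  expectation of \<open>f\<close> at a random subset of \<open>D\<close> that contains each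
  \<open>i\<close> independently with probability \<open>y i\<close>.\<close>

definition multiaffine :: "'a set \<Rightarrow> ('a set \<Rightarrow> real) \<Rightarrow> ('a \<Rightarrow> real) \<Rightarrow> real" where
  "multiaffine D f y = (\<Sum>\<alpha>\<in>Pow D. f \<alpha> * (\<Prod>i\<in>\<alpha>. y i) * (\<Prod>j\<in>D - \<alpha>. 1 - y j))"

lemma multiaffine_cong:
  assumes "\<And>\<alpha>. \<alpha> \<subseteq> D \<Longrightarrow> f \<alpha> = f' \<alpha>" "\<And>i. i \<in> D \<Longrightarrow> y i = y' i"
  shows "multiaffine D f y = multiaffine D f' y'"
  unfolding multiaffine_def using assms
  by (intro sum.cong refl arg_cong2[where f = "(*)"] prod.cong) auto

lemma multiaffine_diff:
  "multiaffine D (\<lambda>\<alpha>. f \<alpha> - f' \<alpha>) y = multiaffine D f y - multiaffine D f' y"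
  unfolding multiaffine_def by (simp add: sum_subtractf left_diff_distrib)

lemma multiaffine_nonneg:
  assumes "\<And>\<alpha>. \<alpha> \<subseteq> D \<Longrightarrow> 0 \<le> f \<alpha>" "\<And>i. i \<in> D \<Longrightarrow> 0 \<le> y i \<and> y i \<le> 1"
  shows "0 \<le> multiaffine D f y"
  unfolding multiaffine_def using assms
  by (intro sum_nonneg mult_nonneg_nonneg prod_nonneg) auto

lemma multiaffine_insert:
  assumes "finite D" "b \<notin> D"
  shows "multiaffine (insert b D) f y =
    y b * multiaffine D (\<lambda>\<alpha>. f (insert b \<alpha>)) y + (1 - y b) * multiaffine D f y"
  unfolding multiaffine_def sum_Pow_insert[OF assms] sum_distrib_left sum.distrib[symmetric]
proof (rule sum.cong[OF refl])
  fix \<alpha> assume "\<alpha> \<in> Pow D"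
  then have \<alpha>: "\<alpha> \<subseteq> D" "finite \<alpha>" "b \<notin> \<alpha>"
    using assms by (auto intro: finite_subset)
  then have "insert b D - \<alpha> = insert b (D - \<alpha>)" "insert b D - insert b \<alpha> = D - \<alpha>"
    using assms by auto
  with \<alpha> assms show "f \<alpha> * prod y \<alpha> * (\<Prod>j\<in>insert b D - \<alpha>. 1 - y j)
      + f (insert b \<alpha>) * prod y (insert b \<alpha>) * (\<Prod>j\<in>insert b D - insert b \<alpha>. 1 - y j)
      = y b * (f (insert b \<alpha>) * prod y \<alpha> * (\<Prod>j\<in>D - \<alpha>. 1 - y j))
      + (1 - y b) * (f \<alpha> * prod y \<alpha> * (\<Prod>j\<in>D - \<alpha>. 1 - y j))"
    by simp
qed

lemma multiaffine_const:
  assumes "finite D"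
  shows "multiaffine D (\<lambda>_. c) y = c"
  using assms
proof (induction D rule: finite_induct)
  case empty
  then show ?case by (simp add: multiaffine_def)
next
  case (insert b D)
  then show ?case by (simp add: multiaffine_insert algebra_simps)
qed

text \<open>Removing \<open>b\<close> in the second term makes the value independent of whether
  \<open>b \<in> \<alpha>\<close>. The derivative thus lives on subsets of the same ground set,
  which stays fixed throughout the induction.\<close>

definition discrete_deriv :: "'a \<Rightarrow> ('a set \<Rightarrow> real) \<Rightarrow> 'a set \<Rightarrow> real" where
  "discrete_deriv b f \<alpha> = f (insert b \<alpha>) - f (\<alpha> - {b})"

text \<open>The extension is affine in coordinate \<open>b\<close>, and its slope depends only on
  the other coordinates, where \<open>y\<close> and \<open>z\<close> agree.\<close>

lemma multiaffine_upd_diff: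
  assumes "finite D" "b \<in> D" "\<And>i. i \<in> D \<Longrightarrow> i \<noteq> b \<Longrightarrow> y i = z i"
  shows "multiaffine D f y - multiaffine D f z = (y b - z b) * multiaffine D (discrete_deriv b f) z"
proof -
  define E where "E = D - {b}"
  have E: "finite E" "b \<notin> E" "D = insert b E"
    using assms by (auto simp: E_def)
  have yz: "multiaffine E u y = multiaffine E u z" for u
    using assms(3) by (intro multiaffine_cong) (auto simp: E_def)
  \<comment> \<open>Both halves of the expansion along \<open>b\<close> coincide because the
    derivative ignores \<open>b\<close>.\<close>
  have "multiaffine E (discrete_deriv b f) z = multiaffine E (\<lambda>\<alpha>. f (insert b \<alpha>) - f \<alpha>) z"
    and "multiaffine E (\<lambda>\<alpha>. discrete_deriv b f (insert b \<alpha>)) z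
      = multiaffine E (\<lambda>\<alpha>. f (insert b \<alpha>) - f \<alpha>) z"
    using E(2) by (auto intro!: multiaffine_cong arg_cong[where f = f] simp: discrete_deriv_def)
  note diff = this[unfolded multiaffine_diff]
  show ?thesis
    unfolding E(3) multiaffine_insert[OF E(1,2)] yz diff by (simp add: algebra_simps)
qed

section \<open>Composition with monotone set functions\<close>

text \<open>
  The case \<open>\<beta> = {}\<close> makes \<open>f\<close> itself nonnegative, unlike in \<^const>\<open>fully_increasing\<close>;
  a monotone \<open>f\<close> satisfies this after subtraction of \<open>f {}\<close>.
\<close>

definition set_increasing :: "'a set \<Rightarrow> nat \<Rightarrow> ('a set \<Rightarrow> real) \<Rightarrow> bool" where
  "set_increasing D n f \<longleftrightarrow> (\<forall>\<alpha>\<subseteq>D. \<forall>\<beta>\<subseteq>D. \<alpha> \<inter> \<beta> = {} \<longrightarrow> card \<beta> \<le> n \<longrightarrow>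
    0 \<le> moebius (\<lambda>T. f (\<alpha> \<union> T)) \<beta>)"

lemma set_increasing_nonneg:
  "set_increasing D n f \<Longrightarrow> \<alpha> \<subseteq> D \<Longrightarrow> 0 \<le> f \<alpha>"
  unfolding set_increasing_def by (drule spec[of _ \<alpha>]) (auto dest: spec[of _ "{}"])

text \<open>A coefficient of the derivative at \<open>\<beta>\<close> is one of \<open>f\<close> at
  \<open>insert b \<beta>\<close>, hence the loss of one order. If \<open>b \<in> \<beta>\<close>
  already, it vanishes, as the derivative is constant in direction \<open>b\<close>.\<close>

lemma set_increasing_discrete_deriv:
  assumes "finite D" "b \<in> D" "set_increasing D (Suc n) f"
  shows "set_increasing D n (discrete_deriv b f)"
  unfolding set_increasing_def
proof (intro allI impI)
  fix \<alpha> \<beta> assume *: "\<alpha> \<subseteq> D" "\<beta> \<subseteq> D" "\<alpha> \<inter> \<beta> = {}" "card \<beta> \<le> n"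
  then have fin: "finite \<beta>"
    using assms finite_subset by blast
  show "0 \<le> moebius (\<lambda>T. discrete_deriv b f (\<alpha> \<union> T)) \<beta>"
  proof (cases "b \<in> \<beta>")
    case True
    define \<gamma> where "\<gamma> = \<beta> - {b}"
    have "\<beta> = insert b \<gamma>" "finite \<gamma>" "b \<notin> \<gamma>"
      using True fin by (auto simp: \<gamma>_def)
    then have "moebius (\<lambda>T. discrete_deriv b f (\<alpha> \<union> T)) \<beta> = moebius (\<lambda>T. 0) \<gamma>"
      by (simp add: moebius_insert discrete_deriv_def insert_Diff_if)
    then show ?thesis
      by (simp add: moebius_def)
  next
    case False
    \<comment> \<open>The base must be disjoint from \<open>insert b \<beta>\<close>; the derivative
      does not see the removal of \<open>b\<close>.\<close>
    let ?\<alpha> = "\<alpha> - {b}"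
    have "moebius (\<lambda>T. discrete_deriv b f (\<alpha> \<union> T)) \<beta>
        = moebius (\<lambda>T. f (?\<alpha> \<union> insert b T) - f (?\<alpha> \<union> T)) \<beta>"
      using False by (intro moebius_cong)
        (auto simp: discrete_deriv_def intro!: arg_cong2[where f = "(-)"] arg_cong[where f = f])
    also have "\<dots> = moebius (\<lambda>T. f (?\<alpha> \<union> T)) (insert b \<beta>)"
      using fin False by (simp add: moebius_insert)
    also have "\<dots> \<ge> 0"
    proof -
      have "?\<alpha> \<subseteq> D" "insert b \<beta> \<subseteq> D" "?\<alpha> \<inter> insert b \<beta> = {}" "card (insert b \<beta>) \<le> Suc n"
        using * fin False assms(2) by auto
      then show ?thesis
        using assms(3) unfolding set_increasing_def by blast
    qed
    finally show ?thesis .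
  qed
qed

text \<open>Induction on \<open>S\<close>: each element of \<open>S\<close> costs one order of
  \<open>f\<close>, which \<open>card S \<le> n\<close> pays for. \<open>G\<close> is generalised
  because the induction hypothesis is applied to mixtures.\<close>

lemma moebius_nonneg_multiaffine:
  fixes d :: nat
  assumes "finite S" "card S \<le> n" "set_increasing {1..d} n f"
    "\<And>i. i \<in> {1..d} \<Longrightarrow> moebius_nonneg S (G i)"
    "\<And>i T. i \<in> {1..d} \<Longrightarrow> T \<subseteq> S \<Longrightarrow> 0 \<le> G i T \<and> G i T \<le> 1"
  shows "moebius_nonneg S (\<lambda>T. multiaffine {1..d} f (\<lambda>i. G i T))"
  using assms
proof (induction S arbitrary: n f G rule: finite_induct)
  case empty
  have "0 \<le> multiaffine {1..d} f (\<lambda>i. G i {})"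
    using empty by (intro multiaffine_nonneg set_increasing_nonneg) auto
  then show ?case
    by (simp add: moebius_nonneg_def)
next
  case (insert a S)
  let ?D = "{1..d}"
  from insert.prems insert.hyps obtain m where m: "n = Suc m" "card S \<le> m"
    by (cases n) auto
  \<comment> \<open>On \<open>{1..d}\<close>, \<open>mix 1\<close> is entirely old and
    \<open>mix (Suc d)\<close> entirely new; passing from \<open>l\<close> to \<open>Suc l\<close>
    changes coordinate \<open>l\<close> only.\<close>
  define mix where "mix = (\<lambda>l i T. if i < l then G i (insert a T) else G i T)"
  have G: "moebius_nonneg S (G i)" "moebius_nonneg S (\<lambda>T. G i (insert a T) - G i T)"
    if "i \<in> ?D" for i
    using insert.prems(3)[OF that] insert.hyps by (simp_all add: moebius_nonneg_insert)
  have G_insert: "moebius_nonneg S (\<lambda>T. G i (insert a T))" if "i \<in> ?D" for i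
    using moebius_nonneg_add[OF G[OF that]] by simp
  have mix_nonneg: "moebius_nonneg S (mix l i)" if "i \<in> ?D" for l i
    using G(1) G_insert that by (cases "i < l") (simp_all add: mix_def)
  have mix_01: "0 \<le> mix l i T \<and> mix l i T \<le> 1" if "i \<in> ?D" "T \<subseteq> S" for l i T
    using insert.prems(4)[OF that(1), of T] insert.prems(4)[OF that(1), of "insert a T"] that
    by (auto simp: mix_def)
  have telescope: "multiaffine ?D f (\<lambda>i. G i (insert a T)) - multiaffine ?D f (\<lambda>i. G i T)
    = (\<Sum>l\<in>?D. (G l (insert a T) - G l T)
        * multiaffine ?D (discrete_deriv l f) (\<lambda>i. mix l i T))" for T
  proof -
    have "multiaffine ?D f (\<lambda>i. G i (insert a T)) - multiaffine ?D f (\<lambda>i. G i T)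
        = multiaffine ?D f (\<lambda>i. mix (Suc d) i T) - multiaffine ?D f (\<lambda>i. mix 1 i T)"
      by (intro arg_cong2[where f = "(-)"] multiaffine_cong) (auto simp: mix_def)
    also have "\<dots> = (\<Sum>l\<in>?D. multiaffine ?D f (\<lambda>i. mix (Suc l) i T)
        - multiaffine ?D f (\<lambda>i. mix l i T))"
      by (rule sum_Suc_diff[symmetric]) simp
    also have "\<dots> = (\<Sum>l\<in>?D. (G l (insert a T) - G l T)
        * multiaffine ?D (discrete_deriv l f) (\<lambda>i. mix l i T))"
    proof (rule sum.cong[OF refl])
      fix l assume "l \<in> ?D"
      then show "multiaffine ?D f (\<lambda>i. mix (Suc l) i T) - multiaffine ?D f (\<lambda>i. mix l i T)
        = (G l (insert a T) - G l T) * multiaffine ?D (discrete_deriv l f) (\<lambda>i. mix l i T)"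
        by (subst multiaffine_upd_diff[where b = l]) (auto simp: mix_def)
    qed
    finally show ?thesis .
  qed
  have "moebius_nonneg S (\<lambda>T. \<Sum>l\<in>?D. (G l (insert a T) - G l T)
      * multiaffine ?D (discrete_deriv l f) (\<lambda>i. mix l i T))"
  proof (intro moebius_nonneg_sum moebius_nonneg_mult insert.hyps(1) G(2))
    fix l assume "l \<in> ?D"
    then have "set_increasing ?D m (discrete_deriv l f)"
      using insert.prems(2) m by (intro set_increasing_discrete_deriv) auto
    with m(2) show "moebius_nonneg S (\<lambda>T. multiaffine ?D (discrete_deriv l f) (\<lambda>i. mix l i T))"
      by (intro insert.IH mix_nonneg mix_01)
  qed
  \<comment> \<open>The coefficients at sets without \<open>a\<close> involve \<open>f\<close>
    itself, so here the order stays \<open>n\<close>.\<close>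
  moreover have "moebius_nonneg S (\<lambda>T. multiaffine ?D f (\<lambda>i. G i T))"
    using m by (intro insert.IH[of n] insert.prems(2,4) G(1)) auto
  ultimately show ?case
    unfolding moebius_nonneg_insert[OF insert.hyps(1,2)] telescope by (rule conjI[rotated])
qed

section \<open>Differences as Moebius coefficients\<close>

definition bin_vec :: "nat \<Rightarrow> nat set \<Rightarrow> nat \<Rightarrow> nat" where
  "bin_vec m S = (\<lambda>i\<in>{1..m}. if i \<in> S then 1 else 0)"

lemma bin_vec_in_cube: "bin_vec m S \<in> cube m"
  by (auto simp: bin_vec_def cube_def prod_box_def)

lemma bin_vec_support:
  assumes "p \<in> cube m"
  shows "p = bin_vec m {i\<in>{1..m}. p i = 1}"
proof
  fix i
  show "p i = bin_vec m {i\<in>{1..m}. p i = 1} i"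
    using assms PiE_mem[of p "{1..m}" "\<lambda>_. {0, 1}" i] PiE_arb[of p "{1..m}" "\<lambda>_. {0, 1}" i]
    unfolding cube_def prod_box_def bin_vec_def by auto
qed

lemma weight_bin_vec:
  assumes "S \<subseteq> {1..m}"
  shows "weight m (bin_vec m S) = card S"
proof -
  have "weight m (bin_vec m S) = (\<Sum>i\<in>{1..m}. if i \<in> S then 1 else 0)"
    unfolding weight_def bin_vec_def by (intro sum.cong) simp_all
  also have "\<dots> = (\<Sum>i\<in>{1..m} \<inter> S. 1)"
    by (rule sum.inter_restrict[symmetric]) simp
  finally show ?thesis
    using assms by (simp add: Int_absorb1)
qed

lemma support_bin_vec:
  assumes "S \<subseteq> {1..m}"
  shows "{i\<in>{1..m}. bin_vec m S i = 1} = S"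
proof -
  have "{i\<in>{1..m}. bin_vec m S i = 1} = {1..m} \<inter> S"
    by (auto simp: bin_vec_def)
  with assms show ?thesis
    by (simp add: Int_absorb1)
qed

lemma bin_vec_eq_iff:
  assumes "S \<subseteq> {1..m}" "T \<subseteq> {1..m}"
  shows "bin_vec m S = bin_vec m T \<longleftrightarrow> S = T"
  using support_bin_vec[OF assms(1)] support_bin_vec[OF assms(2)] by metis

lemma zero_vec_eq: "zero_vec m = bin_vec m {}"
  by (simp add: zero_vec_def bin_vec_def)

lemma below_bin_vec:
  assumes "S \<subseteq> {1..m}"
  shows "below m (bin_vec m S) = bin_vec m ` Pow S"
proof (intro equalityI subsetI)
  fix q assume q: "q \<in> below m (bin_vec m S)"
  have "i \<in> S" if "i \<in> {1..m}" "q i = 1" for i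
  proof -
    have "q i \<le> bin_vec m S i"
      using q that(1) unfolding below_def by blast
    with that show ?thesis
      by (auto simp: bin_vec_def split: if_splits)
  qed
  then have "{i\<in>{1..m}. q i = 1} \<subseteq> S" by blast
  moreover have "q = bin_vec m {i\<in>{1..m}. q i = 1}"
    using q by (intro bin_vec_support) (simp add: below_def)
  ultimately show "q \<in> bin_vec m ` Pow S" by blast
next
  fix q assume "q \<in> bin_vec m ` Pow S"
  then obtain T where "q = bin_vec m T" "T \<subseteq> S" by blast
  then show "q \<in> below m (bin_vec m S)"
    unfolding below_def using bin_vec_in_cube[of m T] by (auto simp: bin_vec_def)
qed

lemma Delta_bin_vec:
  assumes "S \<subseteq> {1..m}"
  shows "Delta m (bin_vec m S) t F s = moebius (\<lambda>T. F (shift m s (bin_vec m T) t)) S"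
proof -
  have inj: "inj_on (bin_vec m) (Pow S)"
    using assms by (auto simp: inj_on_def bin_vec_eq_iff)
  show ?thesis
    unfolding Delta_def below_bin_vec[OF assms] sum.reindex[OF inj] moebius_def o_def
    using assms by (intro sum.cong refl) (simp add: weight_bin_vec subset_trans)
qed

text \<open>Replacing each 0-1 vector by its support turns differences into Moebius coefficients
  with \<open>s\<close> and \<open>t\<close> fixed.\<close>

lemma fully_increasing_iff:
  "fully_increasing m k I F \<longleftrightarrow>
    (\<forall>S\<subseteq>{1..m}. S \<noteq> {} \<longrightarrow> card S \<le> k \<longrightarrow>
      (\<forall>s\<in>prod_box m I. \<forall>t\<in>prod_box m (\<lambda>_. {0..}).
        (\<forall>T\<subseteq>S. shift m s (bin_vec m T) t \<in> prod_box m I) \<longrightarrow>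
        0 \<le> moebius (\<lambda>T. F (shift m s (bin_vec m T) t)) S))"
proof -
  have cube: "cube m = bin_vec m ` Pow {1..m}"
    using bin_vec_support bin_vec_in_cube by blast
  have nonzero: "bin_vec m S \<noteq> zero_vec m \<longleftrightarrow> S \<noteq> {}" if "S \<subseteq> {1..m}" for S
    using that by (simp add: zero_vec_eq bin_vec_eq_iff)
  have below: "(\<forall>q\<in>below m (bin_vec m S). Q q) \<longleftrightarrow> (\<forall>T\<subseteq>S. Q (bin_vec m T))"
    if "S \<subseteq> {1..m}" for S Q
    unfolding below_bin_vec[OF that] by blast
  have all_cube: "(\<forall>p\<in>cube m. Q p) \<longleftrightarrow> (\<forall>S\<subseteq>{1..m}. Q (bin_vec m S))" for Q
    unfolding cube by blast
  show ?thesis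
    unfolding fully_increasing_def all_cube
    by (intro all_cong1 imp_cong refl) (simp_all only: nonzero below weight_bin_vec Delta_bin_vec)
qed

text \<open>The constant leaves coefficients at nonempty \<open>\<beta>\<close> unchanged; at
  \<open>\<beta> = {}\<close> the claim becomes monotonicity of \<open>f\<close>, available because
  \<open>1 \<le> k\<close>.\<close>

lemma set_increasing_ind_vec:
  assumes "1 \<le> k" "fully_increasing d k (\<lambda>_. {0, 1}) f"
  shows "set_increasing {1..d} k (\<lambda>\<alpha>. f (ind_vec d \<alpha>) - f (ind_vec d {}))"
proof -
  let ?f = "\<lambda>\<alpha>. f (ind_vec d \<alpha>)"
  have pos: "0 \<le> moebius (\<lambda>T. ?f (\<alpha> \<union> T)) \<beta>"
    if "\<alpha> \<subseteq> {1..d}" "\<beta> \<subseteq> {1..d}" "\<alpha> \<inter> \<beta> = {}" "\<beta> \<noteq> {}" "card \<beta> \<le> k" for \<alpha> \<beta>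
  proof -
    \<comment> \<open>Unit steps lead from the vector of \<open>\<alpha>\<close> to that of
      \<open>\<alpha> \<union> T\<close>; disjointness keeps every coordinate at most 1.\<close>
    let ?t = "\<lambda>i\<in>{1..d}. 1 :: real"
    have shift: "shift d (ind_vec d \<alpha>) (bin_vec d T) ?t = ind_vec d (\<alpha> \<union> T)" if "T \<subseteq> \<beta>" for T
      using that \<open>\<alpha> \<inter> \<beta> = {}\<close>
      by (auto simp: shift_def ind_vec_def bin_vec_def indicator_def fun_eq_iff
          zero_ereal_def one_ereal_def)
    have box: "ind_vec d \<gamma> \<in> prod_box d (\<lambda>_. {0, 1})" for \<gamma>
      by (auto simp: ind_vec_def prod_box_def indicator_def)
    have "?t \<in> prod_box d (\<lambda>_. {0..})"
      by (auto simp: prod_box_def)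
    then have "0 \<le> moebius (\<lambda>T. f (shift d (ind_vec d \<alpha>) (bin_vec d T) ?t)) \<beta>"
      using assms(2)[unfolded fully_increasing_iff] that box shift by simp
    then show ?thesis
      using moebius_cong[of \<beta> "\<lambda>T. f (shift d (ind_vec d \<alpha>) (bin_vec d T) ?t)"] shift by simp
  qed
  \<comment> \<open>Elements are added one at a time, each by a first-order difference.\<close>
  have mono: "?f {} \<le> ?f \<alpha>" if "\<alpha> \<subseteq> {1..d}" for \<alpha>
  proof -
    have "finite \<alpha>" using that finite_subset by blast
    then show ?thesis using that
    proof (induction \<alpha> rule: finite_induct)
      case (insert b \<alpha>)
      have "0 \<le> moebius (\<lambda>T. ?f (\<alpha> \<union> T)) {b}"
        using insert assms(1) by (intro pos) auto
      then show ?case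
        using insert by (simp add: moebius_insert)
    qed simp
  qed
  show ?thesis
    unfolding set_increasing_def
  proof (intro allI impI)
    fix \<alpha> \<beta> assume *: "\<alpha> \<subseteq> {1..d}" "\<beta> \<subseteq> {1..d}" "\<alpha> \<inter> \<beta> = {}" "card \<beta> \<le> k"
    show "0 \<le> moebius (\<lambda>T. ?f (\<alpha> \<union> T) - ?f {}) \<beta>"
    proof (cases "\<beta> = {}")
      case True
      then show ?thesis using mono * by simp
    next
      case False
      then have "moebius (\<lambda>T. ?f {}) \<beta> = 0"
        using * by (intro moebius_const) (auto intro: finite_subset)
      then show ?thesis
        using pos[of \<alpha> \<beta>] * False by (simp add: moebius_diff)
    qed
  qed
qed

theorem theorem1:
  fixes k d :: nat
    and A :: "nat \<Rightarrow> ereal set"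
    and g :: "nat \<Rightarrow> (nat \<Rightarrow> ereal) \<Rightarrow> real"
    and f :: "(nat \<Rightarrow> ereal) \<Rightarrow> real"
    and h :: "(nat \<Rightarrow> ereal) \<Rightarrow> real"
  assumes "1 \<le> k" and "k \<le> d"
    and "\<forall>j\<in>{1..k}. A j \<noteq> {}"
    and "\<forall>i\<in>{1..d}. \<forall>x\<in>prod_box k A. g i x \<in> {0..1}"
    and "\<forall>x\<in>prod_box k A. h x =
      (\<Sum>\<alpha>\<in>Pow {1..d}. f (ind_vec d \<alpha>) * (\<Prod>i\<in>\<alpha>. g i x) * (\<Prod>j\<in>{1..d} - \<alpha>. 1 - g j x))"
    and "\<forall>i\<in>{1..d}. fully_increasing k k A (g i)"
    and "fully_increasing d k (\<lambda>_. {0, 1}) f"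
  shows "fully_increasing k k A h"
  unfolding fully_increasing_iff
proof (intro allI ballI impI)
  fix S s t
  assume S: "S \<subseteq> {1..k}" "S \<noteq> {}" "card S \<le> k"
    and st: "s \<in> prod_box k A" "t \<in> prod_box k (\<lambda>_. {0..})"
    and box: "\<forall>T\<subseteq>S. shift k s (bin_vec k T) t \<in> prod_box k A"
  let ?x = "\<lambda>T. shift k s (bin_vec k T) t"
  let ?f = "\<lambda>\<alpha>. f (ind_vec d \<alpha>) - f (ind_vec d {})"
  define c where "c = f (ind_vec d {})"
  have fin: "finite S"
    using S finite_subset by blast
  have g01: "0 \<le> g i (?x T) \<and> g i (?x T) \<le> 1" if "i \<in> {1..d}" "T \<subseteq> S" for i T
    using assms(4) box that by auto
  have g_nonneg: "moebius_nonneg S (\<lambda>T. g i (?x T))" if i: "i \<in> {1..d}" for i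
    unfolding moebius_nonneg_def
  proof (intro allI impI)
    fix W assume W: "W \<subseteq> S"
    show "0 \<le> moebius (\<lambda>T. g i (?x T)) W"
    proof (cases "W = {}")
      \<comment> \<open>The empty set corresponds to no difference in
        \<open>fully_increasing\<close>; the lower bound 0 on \<open>g i\<close> covers it.\<close>
      case True
      then show ?thesis using g01[OF i, of "{}"] by simp
    next
      case False
      \<comment> \<open>The corners for \<open>W\<close> are among those for \<open>S\<close>, so
        the same \<open>s\<close> and \<open>t\<close> serve for every \<open>W\<close>.\<close>
      have "card W \<le> k"
        using card_mono[OF fin W] S(3) by simp
      moreover have "W \<subseteq> {1..k}" "\<forall>T\<subseteq>W. ?x T \<in> prod_box k A"
        using W S(1) box by auto
      ultimately show ?thesis
        using assms(6)[unfolded fully_increasing_iff] i st False by blast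
    qed
  qed
  \<comment> \<open>The extension reproduces constants, so normalising \<open>f\<close> shifts
    \<open>h\<close> by \<open>c\<close>; this shift drops out below since \<open>S\<close> is
    nonempty.\<close>
  have h: "h (?x T) = multiaffine {1..d} ?f (\<lambda>i. g i (?x T)) + c" if "T \<subseteq> S" for T
    using assms(5) box that
    by (simp add: multiaffine_diff multiaffine_const c_def)
      (simp add: multiaffine_def)
  have "moebius_nonneg S (\<lambda>T. multiaffine {1..d} ?f (\<lambda>i. g i (?x T)))"
    using fin S(3) set_increasing_ind_vec[OF assms(1,7)] g_nonneg g01
    by (rule moebius_nonneg_multiaffine)
  moreover have "moebius (\<lambda>T. h (?x T)) S
      = moebius (\<lambda>T. multiaffine {1..d} ?f (\<lambda>i. g i (?x T))) S"
    using moebius_cong[OF h, of S] fin S(2) by (simp add: moebius_add moebius_const)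
  ultimately show "0 \<le> moebius (\<lambda>T. h (?x T)) S"
    by (simp add: moebius_nonneg_def)
qed

end
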